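(* Fix any $p>0$. There exist some $G\in\mathcal{G}_p(1)$ and $c=c(p)>0$ such that, for every integer $n\ge2$, with $Y_1,\ldots,Y_n$ i.i.d. observations from $f_G$ and $\tilde f(y)=\frac1n\sum_{i=1}^n\mathbf{1}\{Y_i=y\}$, $y\in\mathbb{Z}_+$, the empirical estimator, $$\mathbb{E}_GH^2(\tilde f,f_G)\ge c\,n^{-\frac{p}{p+1}}(\log n)^{-\frac{4}{p+1}}.$$
   Context: $\mathbb{R}_+=[0,\infty)$, $\mathbb{Z}_+=\{0,1,2,\ldots\}$. $\mathcal{G}_p(1)$ is the set of Borel probability measures $G$ on $\mathbb{R}_+$ with $\int u^pG(du)\le1$. $f_G(y)=\int\frac{e^{-\theta}\theta^y}{y!}G(d\theta)$ is the Poisson mixture with mixing distribution $G$. $H^2(f,g)=\sum_{y\ge0}(\sqrt{f(y)}-\sqrt{g(y)})^2$ is the squared Hellinger distance. *)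

theory Defs
  imports "HOL-Probability.Probability"
begin

text \<open>A Borel measure on the half-line is represented by a Borel measure on the reals that gives
  no mass to the negative numbers. The moment is an extended nonnegative integral, so the bound
  includes finiteness.\<close>

definition mixing_class :: "real \<Rightarrow> real measure set" where
  "mixing_class p = {G. prob_space G \<and> sets G = sets borel \<and> (AE u in G. 0 \<le> u) \<and>
     (\<integral>\<^sup>+ u. ennreal (u powr p) \<partial>G) \<le> 1}"

definition poisson_mixture :: "real measure \<Rightarrow> nat \<Rightarrow> real" where
  "poisson_mixture G y = (\<integral>\<theta>. exp (- \<theta>) * \<theta> ^ y / fact y \<partial>G)"

definition poisson_mixture_law :: "real measure \<Rightarrow> nat measure" where
  "poisson_mixture_law G = density (count_space UNIV) (\<lambda>y. ennreal (poisson_mixture G y))"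

definition hellinger_sq :: "(nat \<Rightarrow> real) \<Rightarrow> (nat \<Rightarrow> real) \<Rightarrow> real" where
  "hellinger_sq f g = (\<Sum>y. (sqrt (f y) - sqrt (g y))\<^sup>2)"

definition empirical :: "nat \<Rightarrow> (nat \<Rightarrow> nat) \<Rightarrow> nat \<Rightarrow> real" where
  "empirical n Y y = (\<Sum>i=1..n. of_bool (Y i = y)) / real n"

text \<open>The expectation over an i.i.d. sample is taken on the canonical sample space, i.e. over the
  \<open>n\<close>-fold product of the mixture law. The lemma \<open>expectation_iid\<close> below shows that this is the
  expectation for i.i.d. observations on any probability space.\<close>

definition expected_hellinger_sq :: "real measure \<Rightarrow> nat \<Rightarrow> real" where
  "expected_hellinger_sq G n =
     (\<integral>Y. hellinger_sq (empirical n Y) (poisson_mixture G) \<partial>PiM {1..n} (\<lambda>_. poisson_mixture_law G))"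

lemma sets_poisson_mixture_law [simp, measurable_cong]:
  "sets (poisson_mixture_law G) = sets (count_space UNIV)"
  by (simp add: poisson_mixture_law_def)

lemma prob_space_poisson_mixture_law:
  assumes "G \<in> mixing_class p"
  shows "prob_space (poisson_mixture_law G)"
proof -
  interpret G: prob_space G using assms by (simp add: mixing_class_def)
  have sG [measurable_cong]: "sets G = sets borel" and nonneg: "AE u in G. 0 \<le> u"
    using assms by (auto simp: mixing_class_def)
  let ?k = "\<lambda>\<theta> y. exp (- \<theta>) * \<theta> ^ y / fact y :: real"
  have sums: "(\<lambda>y. ?k \<theta> y) sums 1" for \<theta>
    using sums_mult[OF exp_converges[of \<theta>], of "exp (- \<theta>)"]
    by (simp add: field_simps exp_minus)
  have le1: "?k \<theta> y \<le> 1" if "0 \<le> \<theta>" for \<theta> y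
    using sum_le_suminf[OF sums_summable[OF sums[of \<theta>]], of "{y}"] sums_unique[OF sums[of \<theta>]] that
    by simp
  have int: "integrable G (\<lambda>\<theta>. ?k \<theta> y)" for y
  proof (rule G.integrable_const_bound[where B = 1])
    show "AE \<theta> in G. norm (?k \<theta> y) \<le> 1"
      using nonneg
    proof eventually_elim
      case (elim \<theta>)
      with le1[OF elim, of y] show ?case by simp
    qed
  qed measurable
  have nn: "ennreal (poisson_mixture G y) = (\<integral>\<^sup>+\<theta>. ennreal (?k \<theta> y) \<partial>G)" for y
    unfolding poisson_mixture_def using nonneg
    by (intro nn_integral_eq_integral[OF int, symmetric]) auto
  have "emeasure (poisson_mixture_law G) UNIV = (\<Sum>y. ennreal (poisson_mixture G y))"
    by (simp add: poisson_mixture_law_def emeasure_density nn_integral_count_space_nat)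
  also have "\<dots> = (\<integral>\<^sup>+\<theta>. (\<Sum>y. ennreal (?k \<theta> y)) \<partial>G)"
    unfolding nn by (rule nn_integral_suminf[symmetric]) measurable
  also have "\<dots> = (\<integral>\<^sup>+\<theta>. 1 \<partial>G)"
  proof (rule nn_integral_cong_AE)
    show "AE \<theta> in G. (\<Sum>y. ennreal (?k \<theta> y)) = 1"
      using nonneg
    proof eventually_elim
      case (elim \<theta>)
      then have "(\<Sum>y. ennreal (?k \<theta> y)) = ennreal 1"
        by (intro suminf_ennreal_eq sums) simp
      then show ?case by simp
    qed
  qed
  also have "\<dots> = 1" by (simp add: G.emeasure_space_1)
  finally show ?thesis
    by (intro prob_spaceI) (simp add: poisson_mixture_law_def)
qed

lemma expectation_iid:
  assumes M: "prob_space M" and n: "1 \<le> n"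
    and indep: "prob_space.indep_vars M (\<lambda>_. count_space UNIV) Y {1..n}"
    and law: "\<And>i. i \<in> {1..n} \<Longrightarrow> distr M (count_space UNIV) (Y i) = poisson_mixture_law G"
  shows "(\<integral>\<omega>. hellinger_sq (empirical n (\<lambda>i. Y i \<omega>)) (poisson_mixture G) \<partial>M) =
    expected_hellinger_sq G n"
proof -
  interpret prob_space M by fact
  have rv: "random_variable (count_space UNIV) (Y i)" if "i \<in> {1..n}" for i
    using indep that by (auto simp: indep_vars_def)
  let ?P = "PiM {1..n} (\<lambda>_. count_space UNIV) :: (nat \<Rightarrow> nat) measure"
  have PiM_law: "PiM {1..n} (\<lambda>i. distr M (count_space UNIV) (Y i)) =
      PiM {1..n} (\<lambda>_. poisson_mixture_law G)"
    by (intro PiM_cong law) auto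
  have dist: "distr M ?P (\<lambda>\<omega>. \<lambda>i\<in>{1..n}. Y i \<omega>) = PiM {1..n} (\<lambda>_. poisson_mixture_law G)"
    using indep_vars_iff_distr_eq_PiM'[of "{1..n}" Y "\<lambda>_. count_space UNIV"] rv indep n
    unfolding PiM_law by simp
  have meas: "(\<lambda>Y. hellinger_sq (empirical n Y) (poisson_mixture G)) \<in> borel_measurable ?P"
    unfolding hellinger_sq_def empirical_def by measurable
  have rvP: "(\<lambda>\<omega>. \<lambda>i\<in>{1..n}. Y i \<omega>) \<in> M \<rightarrow>\<^sub>M ?P"
    using rv by measurable
  have "expected_hellinger_sq G n =
      (\<integral>\<omega>. hellinger_sq (empirical n (\<lambda>i\<in>{1..n}. Y i \<omega>)) (poisson_mixture G) \<partial>M)"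
    unfolding expected_hellinger_sq_def dist[symmetric] by (rule integral_distr[OF rvP meas])
  moreover have "empirical n (\<lambda>i\<in>{1..n}. Y i \<omega>) = empirical n (\<lambda>i. Y i \<omega>)" for \<omega>
    unfolding empirical_def by (intro ext arg_cong2[where f = "(/)"] sum.cong) auto
  ultimately show ?thesis
    by simp
qed

end

theory Submission
  imports Defs "HOL-Real_Asymp.Real_Asymp"
begin

text \<open>A cell \<open>y\<close> with \<open>n f\<^sub>G(y) \<le> 1/2\<close> is missed by the whole sample with probability at least
  \<open>1/2\<close>, and then contributes \<open>f\<^sub>G(y)\<close> to the loss. Hence the risk is at least half the
  \<open>f\<^sub>G\<close>-mass of any set of such cells. A heavy tail is obtained by mixing exponential laws of mean
  of order \<open>2\<^sup>k\<close> with weights proportional to \<open>2\<^bsup>-kp\<^esup> (k+1)\<^bsup>-4\<^esup>\<close>: the \<open>p\<close>-th moment is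
  finite, and since a Poisson law mixed over an exponential law is geometric, \<open>f\<^sub>G(y)\<close> is of the exact
  order \<open>2\<^bsup>-j(p+1)\<^esup> (j+1)\<^bsup>-4\<^esup>\<close> for \<open>2\<^sup>j \<le> y < 2\<^bsup>j+1\<^esup>\<close>. The bound follows from the cells of the
  dyadic block at which this order falls below \<open>1/n\<close>.\<close>

section \<open>Hellinger loss, missed cells and a lower bound for the risk\<close>

lemma hellinger_sq_terms_summable:
  assumes "\<And>y. 0 \<le> f y" "\<And>y. 0 \<le> g y" "summable f" "summable g"
  shows "summable (\<lambda>y. (sqrt (f y) - sqrt (g y))\<^sup>2)"
    and "hellinger_sq f g \<le> suminf f + suminf g"
proof -
  have le: "(sqrt (f y) - sqrt (g y))\<^sup>2 \<le> f y + g y" for y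
    using assms(1,2)[of y] by (simp add: power2_diff)
  have sm: "summable (\<lambda>y. f y + g y)" using assms(3,4) by (rule summable_add)
  show *: "summable (\<lambda>y. (sqrt (f y) - sqrt (g y))\<^sup>2)"
    by (rule summable_comparison_test[OF _ sm]) (use le in auto)
  have "hellinger_sq f g \<le> (\<Sum>y. f y + g y)"
    unfolding hellinger_sq_def by (intro suminf_le le * sm)
  then show "hellinger_sq f g \<le> suminf f + suminf g"
    using assms(3,4) by (simp add: suminf_add)
qed

lemma empirical_sums_1:
  assumes "n \<ge> 1"
  shows "empirical n Y sums 1"
proof -
  have "empirical n Y sums ((\<Sum>i=1..n. 1) / real n)"
    unfolding empirical_def
  proof (intro sums_divide sums_sum)
    fix i
    show "(\<lambda>y. of_bool (Y i = y) :: real) sums 1"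
      using sums_single[of "Y i" "\<lambda>_. 1::real"] by (simp add: of_bool_def eq_commute)
  qed
  with assms show ?thesis by simp
qed

lemma poisson_mixture_nonneg:
  assumes "G \<in> mixing_class p"
  shows "0 \<le> poisson_mixture G y"
  unfolding poisson_mixture_def
  by (rule integral_nonneg_AE) (use assms in \<open>auto simp: mixing_class_def\<close>)

lemma poisson_mixture_sums_1:
  assumes "G \<in> mixing_class p"
  shows "poisson_mixture G sums 1"
proof -
  interpret prob_space "poisson_mixture_law G"
    by (rule prob_space_poisson_mixture_law[OF assms])
  have "(\<Sum>y. ennreal (poisson_mixture G y)) = ennreal 1"
    using emeasure_space_1
    by (simp add: poisson_mixture_law_def emeasure_density nn_integral_count_space_nat)
  then show ?thesis
    by (intro sums_ennreal[THEN iffD1] poisson_mixture_nonneg[OF assms])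
       (auto simp: sums_iff)
qed

lemma measure_poisson_mixture_law_singleton:
  assumes "G \<in> mixing_class p"
  shows "measure (poisson_mixture_law G) {y} = poisson_mixture G y"
  using poisson_mixture_nonneg[OF assms]
  by (simp add: poisson_mixture_law_def measure_def emeasure_density
      nn_integral_count_space_indicator[symmetric] nn_integral_count_space_finite)

text \<open>Linearity of expectation suffices: missing different cells are dependent events, but
  each contributes its expected loss separately.\<close>

lemma expected_hellinger_sq_ge:
  assumes G: "G \<in> mixing_class p" and n: "n \<ge> 1" and A: "finite A"
    and small: "\<And>y. y \<in> A \<Longrightarrow> real n * poisson_mixture G y \<le> 1 / 2"
  shows "expected_hellinger_sq G n \<ge> (\<Sum>y\<in>A. poisson_mixture G y) / 2"
proof -
  let ?f = "poisson_mixture G"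
  let ?M = "poisson_mixture_law G"
  let ?P = "PiM {1..n} (\<lambda>_. ?M)"
  interpret M: prob_space ?M by (rule prob_space_poisson_mixture_law[OF G])
  interpret P: finite_product_prob_space "\<lambda>_. ?M" "{1..n}" by unfold_locales simp
  have spM: "space ?M = UNIV" by (simp add: poisson_mixture_law_def)
  note f_nonneg = poisson_mixture_nonneg[OF G] and f_sums = poisson_mixture_sums_1[OF G]
  have e_nonneg: "0 \<le> empirical n Y y" for Y y
    by (simp add: empirical_def sum_nonneg)
  note summ = hellinger_sq_terms_summable[OF e_nonneg f_nonneg
      sums_summable[OF empirical_sums_1[OF n]] sums_summable[OF f_sums]]
  define E where "E y = PiE {1..n} (\<lambda>_. - {y::nat})" for y
  have E_sets: "E y \<in> sets ?P" for y
    unfolding E_def by (rule sets_PiM_I_finite) auto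
  have E_prob: "measure ?P (E y) = (1 - ?f y) ^ n" for y
  proof -
    have "measure ?P (E y) = (\<Prod>i\<in>{1..n}. measure ?M (- {y}))"
      unfolding E_def by (rule P.prob_times) auto
    also have "measure ?M (- {y}) = 1 - ?f y"
      using M.prob_compl[of "{y}"] measure_poisson_mixture_law_singleton[OF G]
      by (simp add: spM Compl_eq_Diff_UNIV)
    finally show ?thesis by simp
  qed
  have E_ge: "measure ?P (E y) \<ge> 1 / 2" if "y \<in> A" for y
  proof -
    \<comment> \<open>Bernoulli's inequality for \<open>(1 - ?f y) ^ n\<close> requires
      \<open>- 1 \<le> - ?f y\<close>; it then gives at least \<open>1 - n * ?f y\<close>.\<close>
    have "?f y \<le> real n * ?f y" using n f_nonneg[of y] by (simp add: mult_le_cancel_right1)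
    also have "\<dots> \<le> 1 / 2" by (rule small[OF that])
    finally have "- 1 \<le> - ?f y" by simp
    from Bernoulli_inequality[OF this, of n] small[OF that] show ?thesis
      unfolding E_prob by simp
  qed
  have "integrable ?P (indicator (E y) :: _ \<Rightarrow> real)" for y
    by (rule integrable_real_indicator[OF E_sets])
       (simp only: P.emeasure_eq_measure ennreal_less_top infinity_ennreal_def)
  then have int_E: "integrable ?P (\<lambda>Y. ?f y * indicator (E y) Y)" for y
    by (rule integrable_mult_right)
  have "(\<Sum>y\<in>A. ?f y) / 2 \<le> (\<Sum>y\<in>A. ?f y * measure ?P (E y))"
    unfolding sum_divide_distrib
  proof (rule sum_mono)
    fix y assume "y \<in> A"
    from mult_left_mono[OF E_ge[OF this] f_nonneg[of y]]
    show "?f y / 2 \<le> ?f y * measure ?P (E y)" by simp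
  qed
  also have "\<dots> = (\<integral>Y. (\<Sum>y\<in>A. ?f y * indicator (E y) Y) \<partial>?P)"
    by (simp add: Bochner_Integration.integral_sum[OF int_E] sets.Int_space_eq2[OF E_sets]
        del: sets.Int_space_eq2 One_nat_def)
  also have "\<dots> \<le> (\<integral>Y. hellinger_sq (empirical n Y) ?f \<partial>?P)"
  proof (rule integral_mono)
    show "integrable ?P (\<lambda>Y. \<Sum>y\<in>A. ?f y * indicator (E y) Y)"
      by (rule Bochner_Integration.integrable_sum) (rule int_E)
    have meas: "(\<lambda>Y. hellinger_sq (empirical n Y) ?f) \<in> borel_measurable ?P"
      unfolding hellinger_sq_def empirical_def by measurable
    have nn: "0 \<le> hellinger_sq (empirical n Y) ?f" for Y
      unfolding hellinger_sq_def by (intro suminf_nonneg summ) auto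
    \<comment> \<open>Boundedness secures integrability; the Bochner integral of a non-integrable
      loss would be 0.\<close>
    have "hellinger_sq (empirical n Y) ?f \<le> 2" for Y
      using summ(2)[of Y] sums_unique[OF f_sums] sums_unique[OF empirical_sums_1[OF n, of Y]] by simp
    with nn meas show "integrable ?P (\<lambda>Y. hellinger_sq (empirical n Y) ?f)"
      by (intro P.integrable_const_bound[where B=2]) auto
    fix Y
    \<comment> \<open>On a missed cell the empirical mass is 0 and the squared difference is exactly
      \<open>?f y\<close>.\<close>
    have "?f y * indicator (E y) Y \<le> (sqrt (empirical n Y y) - sqrt (?f y))\<^sup>2" for y
    proof (cases "Y \<in> E y")
      case True
      then have "empirical n Y y = 0"
        unfolding empirical_def E_def by (auto simp: PiE_iff)
      with True f_nonneg[of y] show ?thesis by simp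
    qed simp
    then have "(\<Sum>y\<in>A. ?f y * indicator (E y) Y) \<le>
        (\<Sum>y\<in>A. (sqrt (empirical n Y y) - sqrt (?f y))\<^sup>2)"
      by (intro sum_mono)
    also have "\<dots> \<le> hellinger_sq (empirical n Y) ?f"
      unfolding hellinger_sq_def by (intro sum_le_suminf summ A) auto
    finally show "(\<Sum>y\<in>A. ?f y * indicator (E y) Y) \<le> hellinger_sq (empirical n Y) ?f" .
  qed
  finally show ?thesis unfolding expected_hellinger_sq_def .
qed

section \<open>Mixtures of exponential laws and their Poisson mixtures\<close>

text \<open>\<open>l k\<close> is the rate of component \<open>k\<close>, whose mean is thus
  \<open>1 / l k\<close>. The series is taken in \<open>ennreal\<close>, where it always has a
  value.\<close>

definition exponential_mixture :: "(nat \<Rightarrow> real) \<Rightarrow> (nat \<Rightarrow> real) \<Rightarrow> real measure" where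
  "exponential_mixture w l =
     density lborel (\<lambda>u. \<Sum>k. ennreal (w k * exponential_density (l k) u))"

lemma exponential_density_nonneg: "0 < l \<Longrightarrow> 0 \<le> exponential_density l u"
  by (simp add: exponential_density_def)

lemma sets_exponential_mixture [simp, measurable_cong]: "sets (exponential_mixture w l) = sets borel"
  by (simp add: exponential_mixture_def)

lemma nn_integral_exponential_mixture:
  assumes [measurable]: "h \<in> borel_measurable borel" and w: "\<And>k. 0 \<le> w k"
  shows "(\<integral>\<^sup>+u. h u \<partial>exponential_mixture w l) =
    (\<Sum>k. ennreal (w k) * (\<integral>\<^sup>+u. ennreal (exponential_density (l k) u) * h u \<partial>lborel))"
proof -
  have "(\<integral>\<^sup>+u. h u \<partial>exponential_mixture w l) =
      (\<integral>\<^sup>+u. (\<Sum>k. ennreal (w k) * (ennreal (exponential_density (l k) u) * h u)) \<partial>lborel)"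
    unfolding exponential_mixture_def using w
    by (subst nn_integral_density)
       (auto simp: ennreal_suminf_multc[symmetric] ennreal_mult' mult.assoc)
  then show ?thesis
    by (simp add: nn_integral_suminf nn_integral_cmult)
qed

lemma AE_exponential_mixture_nonneg: "AE u in exponential_mixture w l. 0 \<le> u"
  unfolding exponential_mixture_def
  by (subst AE_density) (auto simp: exponential_density_def simp flip: not_less intro!: AE_I2)

lemma nn_integral_exponential_density:
  "0 < l \<Longrightarrow> (\<integral>\<^sup>+u. ennreal (exponential_density l u) \<partial>lborel) = 1"
  using prob_space.emeasure_space_1[OF prob_space_exponential_density[of l]]
  by (simp add: emeasure_density)

text \<open>Raise \<open>t \<le> exp t\<close> at \<open>t = x / q\<close> to the power
  \<open>q\<close>.\<close>

lemma powr_le_exp: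
  fixes q x :: real
  assumes "0 < q" "0 \<le> x"
  shows "x powr q \<le> q powr q * exp x"
proof -
  have "x / q \<le> exp (x / q)" using exp_ge_add_one_self[of "x / q"] by linarith
  then have "(x / q) powr q \<le> exp (x / q) powr q"
    using assms by (intro powr_mono2) auto
  also have "\<dots> = exp x" using assms by (simp add: exp_powr_real)
  finally show ?thesis using assms by (simp add: powr_divide field_simps)
qed

text \<open>Half of the exponential decay absorbs \<open>u powr p\<close>; what is left is a
  multiple of the density of rate \<open>l / 2\<close>. This replaces the exact Gamma moment and
  keeps its scaling in \<open>l\<close>.\<close>

lemma nn_integral_exponential_density_powr_le:
  assumes p: "0 < p" and l: "0 < l"
  shows "(\<integral>\<^sup>+u. ennreal (exponential_density l u) * ennreal (u powr p) \<partial>lborel)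
    \<le> ennreal (2 * (2 * p / l) powr p)"
proof -
  have "exponential_density l u * u powr p
      \<le> 2 * (2 * p / l) powr p * exponential_density (l / 2) u" for u
  proof (cases "u < 0")
    case False
    then have "(l * u / 2) powr p \<le> p powr p * exp (l * u / 2)"
      using l by (intro powr_le_exp p) auto
    then have "(l * u / 2) powr p * (2 / l) powr p \<le> p powr p * exp (l * u / 2) * (2 / l) powr p"
      by (rule mult_right_mono) simp
    moreover have "(l * u / 2) powr p * (2 / l) powr p = u powr p"
      using l False by (subst powr_mult[symmetric]) auto
    moreover have "p powr p * (2 / l) powr p = (2 * p / l) powr p"
      using l p by (subst powr_mult[symmetric]) (auto simp: mult.commute)
    ultimately have "u powr p \<le> (2 * p / l) powr p * exp (l * u / 2)"
      by (metis (no_types, lifting) mult.commute mult.assoc)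
    then have "l * exp (- u * l) * u powr p \<le> l * exp (- u * l) * ((2 * p / l) powr p * exp (l * u / 2))"
      using l by (intro mult_left_mono) auto
    also have "\<dots> = l * (2 * p / l) powr p * exp (- u * (l / 2))"
      by (simp add: mult_exp_exp mult_ac)
    finally show ?thesis using False by (simp add: exponential_density_def mult_ac)
  qed (simp add: exponential_density_def)
  then have "(\<integral>\<^sup>+u. ennreal (exponential_density l u) * ennreal (u powr p) \<partial>lborel)
      \<le> (\<integral>\<^sup>+u. ennreal (2 * (2 * p / l) powr p) * ennreal (exponential_density (l / 2) u) \<partial>lborel)"
    using l by (intro nn_integral_mono)
      (auto simp: ennreal_mult'[symmetric] ennreal_mult''[symmetric] exponential_density_nonneg intro!: ennreal_leI)
  also have "\<dots> = ennreal (2 * (2 * p / l) powr p)"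
    using l by (simp add: nn_integral_cmult nn_integral_exponential_density)
  finally show ?thesis .
qed

text \<open>The integrand is a multiple of an Erlang density of rate \<open>1 + l\<close>. The
  values form the geometric law with success probability \<open>l / (1 + l)\<close>.\<close>

lemma nn_integral_exponential_density_poisson:
  assumes l: "0 < l"
  shows "(\<integral>\<^sup>+u. ennreal (exponential_density l u) * ennreal (exp (- u) * u ^ y / fact y) \<partial>lborel)
    = ennreal (l / (1 + l) ^ Suc y)"
proof -
  have "exponential_density l u * (exp (- u) * u ^ y / fact y)
      = l / (1 + l) ^ Suc y * erlang_density y (1 + l) u" for u
  proof -
    have "l * exp (- u * l) * (exp (- u) * u ^ y / fact y) = l * ((exp (- u * l) * exp (- u)) * u ^ y / fact y)"
      by simp
    also have "exp (- u * l) * exp (- u) = exp (- (1 + l) * u)"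
      by (simp add: mult_exp_exp algebra_simps)
    finally have "l * exp (- u * l) * (exp (- u) * u ^ y / fact y) = l * (exp (- (1 + l) * u) * u ^ y / fact y)" .
    moreover have "(1 + l) ^ Suc y \<noteq> 0" using l by simp
    ultimately show ?thesis
      by (simp add: exponential_density_def erlang_density_def mult_ac del: power_Suc)
  qed
  then have "(\<integral>\<^sup>+u. ennreal (exponential_density l u) * ennreal (exp (- u) * u ^ y / fact y) \<partial>lborel)
      = (\<integral>\<^sup>+u. ennreal (l / (1 + l) ^ Suc y) * ennreal (erlang_density y (1 + l) u) \<partial>lborel)"
    using l by (intro nn_integral_cong)
      (auto simp: ennreal_mult'[symmetric] exponential_density_nonneg simp del: power_Suc)
  also have "\<dots> = ennreal (l / (1 + l) ^ Suc y)"
    using l prob_space.emeasure_space_1[OF prob_space_erlang_density[of "1 + l" y]]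
    by (simp add: nn_integral_cmult emeasure_density)
  finally show ?thesis .
qed

lemma poisson_mixture_exponential_mixture:
  assumes w: "\<And>k. 0 \<le> w k" "summable w" and l: "\<And>k. 0 < l k"
  shows "summable (\<lambda>k. w k * (l k / (1 + l k) ^ Suc y))"
    and "poisson_mixture (exponential_mixture w l) y = (\<Sum>k. w k * (l k / (1 + l k) ^ Suc y))"
proof -
  have le: "l k / (1 + l k) ^ Suc y \<le> 1" for k
  proof -
    have "1 + l k \<le> (1 + l k) ^ Suc y" using l[of k] by (intro self_le_power) auto
    with l[of k] have "l k \<le> (1 + l k) ^ Suc y" "0 < (1 + l k) ^ Suc y" by linarith+
    then show ?thesis by (simp add: divide_le_eq del: power_Suc)
  qed
  have nn: "0 \<le> w k * (l k / (1 + l k) ^ Suc y)" for k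
    using w(1)[of k] l[of k] by simp
  show s: "summable (\<lambda>k. w k * (l k / (1 + l k) ^ Suc y))"
  proof (rule summable_comparison_test'[OF w(2)])
    fix k
    show "norm (w k * (l k / (1 + l k) ^ Suc y)) \<le> w k"
      using mult_left_le[OF le w(1), of k k] nn[of k] by (simp only: real_norm_def abs_of_nonneg)
  qed
  \<comment> \<open>The integrand can be negative for \<open>u < 0\<close>; passing to the
    nonnegative integral rests on the mixture giving no mass there.\<close>
  have "poisson_mixture (exponential_mixture w l) y =
      enn2real (\<integral>\<^sup>+u. ennreal (exp (- u) * u ^ y / fact y) \<partial>exponential_mixture w l)"
    unfolding poisson_mixture_def using AE_exponential_mixture_nonneg[of w l]
    by (intro integral_eq_nn_integral) (measurable, auto)
  also have "(\<integral>\<^sup>+u. ennreal (exp (- u) * u ^ y / fact y) \<partial>exponential_mixture w l) =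
      (\<Sum>k. ennreal (w k * (l k / (1 + l k) ^ Suc y)))"
    unfolding ennreal_mult'[OF w(1)] nn_integral_exponential_density_poisson[OF l, symmetric]
    by (rule nn_integral_exponential_mixture[OF _ w(1)]) measurable
  also have "\<dots> = ennreal (\<Sum>k. w k * (l k / (1 + l k) ^ Suc y))"
    by (rule suminf_ennreal2[OF nn s])
  finally show "poisson_mixture (exponential_mixture w l) y = (\<Sum>k. w k * (l k / (1 + l k) ^ Suc y))"
    using nn s by (simp add: suminf_nonneg del: power_Suc)
qed

lemma exponential_mixture_mem_mixing_class:
  assumes p: "0 < p" and w: "\<And>k. 0 \<le> w k" "w sums 1" and l: "\<And>k. 0 < l k"
    and moment: "summable (\<lambda>k. w k * (2 * (2 * p / l k) powr p))"
      "(\<Sum>k. w k * (2 * (2 * p / l k) powr p)) \<le> 1"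
  shows "exponential_mixture w l \<in> mixing_class p"
proof -
  have "(\<integral>\<^sup>+u. 1 \<partial>exponential_mixture w l) = (\<Sum>k. ennreal (w k))"
    by (subst nn_integral_exponential_mixture) (use w l in \<open>auto simp: nn_integral_exponential_density\<close>)
  also have "\<dots> = 1" using suminf_ennreal_eq[OF w] by simp
  finally have "prob_space (exponential_mixture w l)" by (intro prob_spaceI) simp
  moreover have "(\<integral>\<^sup>+u. ennreal (u powr p) \<partial>exponential_mixture w l) \<le> 1"
  proof -
    have "(\<integral>\<^sup>+u. ennreal (u powr p) \<partial>exponential_mixture w l)
        \<le> (\<Sum>k. ennreal (w k * (2 * (2 * p / l k) powr p)))"
      unfolding ennreal_mult'[OF w(1)]
      by (subst nn_integral_exponential_mixture)
         (use w p l in \<open>auto intro!: suminf_le mult_left_mono nn_integral_exponential_density_powr_le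
            simp del: ennreal_mult'' ennreal_mult' ennreal_numeral\<close>)
    also have "\<dots> = ennreal (\<Sum>k. w k * (2 * (2 * p / l k) powr p))"
      using w by (intro suminf_ennreal2 moment) auto
    also have "\<dots> \<le> 1" using moment(2) by simp
    finally show ?thesis .
  qed
  ultimately show ?thesis
    using AE_exponential_mixture_nonneg by (simp add: mixing_class_def)
qed

section \<open>Weights with geometric and polynomial decay, summed against geometric tails\<close>

text \<open>Three exponents occur: \<open>p\<close> for the mixing weights, \<open>p + 1\<close> for
  the cell probabilities, 0 for the moment series. The fourth power makes the case 0 summable and
  leads to the exponent \<open>4 / (p + 1)\<close> of the logarithm.\<close>

definition log_decay :: "real \<Rightarrow> nat \<Rightarrow> real" where
  "log_decay q k = 2 powr (- (q * real k)) / (real k + 1) ^ 4"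

lemma log_decay_pos: "0 < log_decay q k"
  by (simp add: log_decay_def add_nonneg_pos)

lemma log_decay_powr: "log_decay q k = 2 powr (- (q * real k)) * (real k + 1) powr (- 4)"
proof -
  have "(real k + 1) ^ 4 = (real k + 1) powr 4" by (simp add: powr_numeral add_nonneg_pos)
  then show ?thesis by (simp only: log_decay_def powr_minus divide_inverse)
qed

lemma log_decay_0 [simp]: "log_decay q 0 = 1"
  by (simp add: log_decay_def)

lemma log_decay_add_exponent: "log_decay (p + r) k = log_decay p k * 2 powr (- (r * real k))"
  by (simp add: log_decay_def powr_add[symmetric] algebra_simps)

text \<open>Used both ways: rates of order \<open>1 / 2 ^ k\<close> turn mixing weights into cell
  probabilities, and summing over the \<open>2 ^ k\<close> cells of a block turns them back.\<close>

lemma log_decay_add_1: "log_decay (p + 1) k = log_decay p k / 2 ^ k"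
  by (simp add: log_decay_add_exponent powr_minus powr_realpow divide_inverse)

lemma summable_log_decay_0: "summable (log_decay 0)"
proof -
  have "summable (\<lambda>k. inverse (real (Suc k) ^ 4))"
    by (subst summable_Suc_iff) (rule inverse_power_summable, simp)
  then show ?thesis
    by (simp add: log_decay_def[abs_def] inverse_eq_divide add.commute)
qed

lemma log_decay_le_log_decay_0: "0 \<le> q \<Longrightarrow> log_decay q k \<le> log_decay 0 k"
  unfolding log_decay_def by (intro divide_right_mono powr_mono) auto

lemma summable_log_decay: "0 \<le> q \<Longrightarrow> summable (log_decay q)"
  by (rule summable_comparison_test'[OF summable_log_decay_0, of 0])
     (use log_decay_pos[of q] in \<open>auto simp: log_decay_le_log_decay_0 less_imp_le abs_of_pos\<close>)

lemma log_decay_add_le: "log_decay q (k + j) \<le> log_decay q j * 2 powr (- (q * real k))"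
proof -
  have "2 powr (- (q * real (k + j))) / (real (k + j) + 1) ^ 4
      \<le> 2 powr (- (q * real (k + j))) / (real j + 1) ^ 4"
    by (intro divide_left_mono power_mono) (auto intro!: mult_pos_pos zero_less_power)
  also have "\<dots> = log_decay q j * 2 powr (- (q * real k))"
    by (simp add: log_decay_def powr_add[symmetric] algebra_simps)
  finally show ?thesis by (simp add: log_decay_def)
qed

text \<open>Since \<open>k + d + 1 \<le> (k + 1) * (d + 1)\<close>, going back \<open>d\<close>
  steps costs a factor depending on \<open>q\<close> and \<open>d\<close> but not on
  \<open>k\<close>.\<close>

lemma log_decay_le_add:
  "log_decay q k \<le> log_decay q (k + d) * (2 powr (q * real d) * (real d + 1) ^ 4)"
proof -
  have "real (k + d) + 1 \<le> (real k + 1) * (real d + 1)" by (simp add: algebra_simps)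
  then have "(real (k + d) + 1) ^ 4 \<le> (real k + 1) ^ 4 * (real d + 1) ^ 4"
    unfolding power_mult_distrib[symmetric] by (rule power_mono) simp
  then have "1 / (real k + 1) ^ 4 \<le> (real d + 1) ^ 4 / (real (k + d) + 1) ^ 4"
    by (simp add: divide_simps mult.commute)
  then have "2 powr (- (q * real k)) * (1 / (real k + 1) ^ 4)
      \<le> 2 powr (- (q * real k)) * ((real d + 1) ^ 4 / (real (k + d) + 1) ^ 4)"
    by (rule mult_left_mono) simp
  moreover have "2 powr (- (q * real k)) = 2 powr (- (q * real (k + d))) * 2 powr (q * real d)"
    by (simp add: powr_add[symmetric] algebra_simps)
  ultimately show ?thesis by (simp add: log_decay_def mult_ac)
qed

text \<open>The numerator is the cost of \<open>d\<close> steps back in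
  \<open>log_decay_le_add\<close>; the denominator is the damping from
  \<open>two_power_le_power_geometric\<close>.\<close>

lemma summable_double_exponential:
  assumes "0 < q"
  shows "summable (\<lambda>d. 2 powr (q * real d) * (real d + 1) ^ 4 / 2 ^ 2 ^ d :: real)"
proof (rule summable_comparison_test_bigo)
  show "summable (\<lambda>d. norm ((1 / 2) ^ d :: real))" by (simp add: summable_geometric)
  have "(\<lambda>d. 2 powr (q * real d) * (real d + 1) ^ 4 / 2 powr (2 powr real d)) \<in> O(\<lambda>d. (1 / 2) powr real d)"
    using assms by real_asymp
  then show "(\<lambda>d. 2 powr (q * real d) * (real d + 1) ^ 4 / 2 ^ 2 ^ d :: real) \<in> O(\<lambda>d. (1 / 2) ^ d)"
    by (simp add: powr_realpow flip: powr_realpow[of 2 "2 ^ _"])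
qed

text \<open>By Bernoulli's inequality \<open>(1 + x) ^ 2 ^ k\<close> is at least 2; raise this to
  the power \<open>2 ^ d\<close>.\<close>

lemma two_power_le_power_geometric:
  assumes "1 / 2 ^ k \<le> (x::real)" "2 ^ (k + d) \<le> m"
  shows "2 ^ 2 ^ d \<le> (1 + x) ^ m"
proof -
  have x: "0 \<le> x" using order_trans[OF _ assms(1), of 0] by simp
  have "1 \<le> 2 ^ k * x" using assms(1) by (simp add: field_simps)
  moreover have "1 + 2 ^ k * x \<le> (1 + x) ^ 2 ^ k"
    using Bernoulli_inequality[of x "2 ^ k"] x by simp
  ultimately have "2 ^ 2 ^ d \<le> ((1 + x) ^ 2 ^ k) ^ 2 ^ d"
    by (intro power_mono) auto
  also have "\<dots> = (1 + x) ^ 2 ^ (k + d)" by (simp add: power_add power_mult)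
  also have "\<dots> \<le> (1 + x) ^ m" using assms(2) x by (intro power_increasing) auto
  finally show ?thesis .
qed

text \<open>Split the series at \<open>j\<close>. For \<open>k \<ge> j\<close> the weights alone
  decay fast enough; for \<open>k < j\<close> the geometric tails outweigh the larger weights.
  \<open>B\<close> depends on \<open>q\<close> only.\<close>

lemma log_decay_geometric_sum_le:
  fixes q :: real
  assumes q: "1 \<le> q"
  obtains B where "0 < B" "\<And>l j y. \<lbrakk>\<And>k. 1 / 2 ^ k \<le> l k; 2 ^ j \<le> y\<rbrakk> \<Longrightarrow>
    (\<Sum>k. log_decay q k / (1 + l k) ^ Suc y) \<le> B * log_decay q j"
proof
  define D where "D d = 2 powr (q * real d) * (real d + 1) ^ 4 / 2 ^ 2 ^ d" for d
  have D_nonneg: "0 \<le> D d" for d by (simp add: D_def)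
  have D: "summable (\<lambda>d. D (Suc d))"
    unfolding D_def by (subst summable_Suc_iff) (rule summable_double_exponential, use q in simp)
  \<comment> \<open>The 2 sums the powers of 1/2 that bound the components from \<open>j\<close> on;
    the series collects the earlier ones by their distance to \<open>j\<close>, which is at least
    1.\<close>
  show "0 < 2 + (\<Sum>d. D (Suc d))"
    by (intro add_pos_nonneg suminf_nonneg D D_nonneg) simp
  fix l :: "nat \<Rightarrow> real" and j y :: nat
  assume l: "\<And>k. 1 / 2 ^ k \<le> l k" and y: "2 ^ j \<le> y"
  define t where "t k = log_decay q k / (1 + l k) ^ Suc y" for k
  have l0: "0 \<le> l k" for k using order_trans[OF _ l, of 0 k] by simp
  have one: "1 \<le> (1 + l k) ^ Suc y" for k
    using l0[of k] by (intro one_le_power) auto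
  have t_le: "t k \<le> log_decay q k" for k
    unfolding t_def using one[of k] log_decay_pos[of q k]
    by (simp add: divide_le_eq mult_le_cancel_left1 del: power_Suc)
  have t_nonneg: "0 \<le> t k" for k
    unfolding t_def using one[of k] log_decay_pos[of q k] by (intro divide_nonneg_nonneg) auto
  have t: "summable t"
    by (rule summable_comparison_test'[OF summable_log_decay[of q], of 0])
       (use q t_le t_nonneg in auto)
  have "t (k + j) \<le> log_decay q j * (1 / 2) ^ k" for k
  proof -
    have "(2::real) powr (- (q * real k)) \<le> 2 powr (- real k)"
      using q mult_right_mono[of 1 q "real k"] by (intro powr_mono) auto
    also have "\<dots> = (1 / 2) ^ k" by (simp add: powr_minus powr_realpow power_one_over inverse_eq_divide)
    finally have "log_decay q j * 2 powr (- (q * real k)) \<le> log_decay q j * (1 / 2) ^ k"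
      using log_decay_pos[of q j] by (intro mult_left_mono) auto
    then show ?thesis using t_le[of "k + j"] log_decay_add_le[of q k j] by linarith
  qed
  then have "(\<Sum>k. t (k + j)) \<le> (\<Sum>k. log_decay q j * (1 / 2) ^ k)"
    using t by (intro suminf_le) (auto intro!: summable_mult summable_geometric)
  also have "\<dots> = 2 * log_decay q j"
    by (subst suminf_mult) (auto simp: suminf_geometric summable_geometric)
  finally have upper: "(\<Sum>k. t (k + j)) \<le> 2 * log_decay q j" .
  \<comment> \<open>For \<open>k < j\<close> the argument of \<open>D\<close> equals
    \<open>j - k\<close>; this form suits reversing the order of summation.\<close>
  have "t k \<le> log_decay q j * D (Suc (j - Suc k))" if "k < j" for k
  proof -
    define d where "d = j - k"
    have j: "j = k + d" "Suc (j - Suc k) = d" using that by (auto simp: d_def)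
    have "2 ^ 2 ^ d \<le> (1 + l k) ^ Suc y"
      by (rule two_power_le_power_geometric[OF l]) (use y j in simp)
    then have "t k \<le> log_decay q k / 2 ^ 2 ^ d"
      unfolding t_def using log_decay_pos[of q k] one[of k]
      by (intro divide_left_mono) (auto simp del: power_Suc)
    also have "\<dots> \<le> log_decay q j * (2 powr (q * real d) * (real d + 1) ^ 4) / 2 ^ 2 ^ d"
      unfolding j(1) by (intro divide_right_mono log_decay_le_add) simp
    finally show ?thesis unfolding j(2) D_def by simp
  qed
  then have "(\<Sum>k<j. t k) \<le> (\<Sum>k<j. log_decay q j * D (Suc (j - Suc k)))"
    by (intro sum_mono) auto
  also have "\<dots> = log_decay q j * (\<Sum>k<j. D (Suc k))"
    unfolding sum_distrib_left[symmetric] by (subst sum.nat_diff_reindex) simp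
  also have "\<dots> \<le> log_decay q j * (\<Sum>d. D (Suc d))"
    using log_decay_pos[of q j] by (intro mult_left_mono sum_le_suminf D) (auto intro: D_nonneg)
  finally have "(\<Sum>k<j. t k) \<le> log_decay q j * (\<Sum>d. D (Suc d))" .
  with upper suminf_split_initial_segment[OF t, of j]
  show "(\<Sum>k. log_decay q k / (1 + l k) ^ Suc y) \<le> (2 + (\<Sum>d. D (Suc d))) * log_decay q j"
    unfolding t_def[symmetric] by (simp add: algebra_simps)
qed

section \<open>Construction of the mixing law\<close>

text \<open>The upper bound sums all geometric components; the lower bound keeps only component
  \<open>j\<close>, whose mean is proportional to \<open>2 ^ j\<close>.\<close>

lemma exists_log_decay_poisson_mixture:
  fixes p :: real
  assumes p: "0 < p"
  obtains G B K where "G \<in> mixing_class p" "0 < B" "0 < K"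
    "\<And>j y. 2 ^ j \<le> y \<Longrightarrow> poisson_mixture G y \<le> B * log_decay (p + 1) j"
    "\<And>j y. y < 2 * 2 ^ j \<Longrightarrow> K * log_decay (p + 1) j \<le> poisson_mixture G y"
proof -
  define W where "W = suminf (log_decay p)"
  define V where "V = suminf (log_decay 0)"
  define C where "C = 2 * (2 * p) powr p"
  \<comment> \<open>The moment bound comes out as \<open>C * V / (W * L powr p)\<close>, and this
    \<open>L\<close> makes it at most 1. The maximum with 1 ensures
    \<open>1 / 2 ^ k \<le> l k\<close>, as \<open>log_decay_geometric_sum_le\<close>
    requires.\<close>
  define L where "L = max 1 ((C * V / W) powr (1 / p))"
  define w where "w k = log_decay p k / W" for k
  define l where "l k = L / 2 ^ k" for k :: nat
  have sump: "summable (log_decay p)" using p by (intro summable_log_decay) simp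
  have W: "0 < W" unfolding W_def by (intro suminf_pos sump log_decay_pos)
  have V: "0 < V" unfolding V_def by (intro suminf_pos summable_log_decay_0 log_decay_pos)
  have C: "0 < C" using p by (simp add: C_def)
  have L: "1 \<le> L" by (simp add: L_def)
  have l_pos: "0 < l k" for k using L by (simp add: l_def)
  have w_nonneg: "0 \<le> w k" for k using W log_decay_pos[of p k] by (simp add: w_def)
  have w_sums: "w sums 1"
    using sums_divide[OF summable_sums[OF sump], of W] W by (simp add: w_def[abs_def] W_def)
  have "C * V / W = ((C * V / W) powr (1 / p)) powr p"
    using p C V W by (simp add: powr_powr)
  also have "\<dots> \<le> L powr p" using p by (intro powr_mono2) (auto simp: L_def)
  finally have CVW: "C * V / W \<le> L powr p" .
  \<comment> \<open>The growth of the component moments cancels the geometric decay of the weights,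
    leaving the factor \<open>1 / (k + 1) ^ 4\<close>.\<close>
  have term_eq: "w k * (2 * (2 * p / l k) powr p) = C / (L powr p * W) * log_decay 0 k" for k
  proof -
    have "2 * p / l k = 2 * p * 2 ^ k / L" by (simp add: l_def)
    then have "(2 * p / l k) powr p = (2 * p) powr p * 2 powr (p * real k) / L powr p"
      using p L by (simp add: powr_divide powr_mult powr_powr mult.commute flip: powr_realpow)
    then have "w k * (2 * (2 * p / l k) powr p) = 2 * (2 * p) powr p / L powr p * (w k * 2 powr (p * real k))"
      by simp
    also have "w k * 2 powr (p * real k) = log_decay 0 k / W"
      by (simp add: w_def log_decay_def powr_add[symmetric])
    finally show ?thesis by (simp add: C_def)
  qed
  define G where "G = exponential_mixture w l"
  have G: "G \<in> mixing_class p"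
    unfolding G_def
  proof (rule exponential_mixture_mem_mixing_class[OF p w_nonneg w_sums l_pos])
    show "summable (\<lambda>k. w k * (2 * (2 * p / l k) powr p))"
      unfolding term_eq by (intro summable_mult summable_log_decay_0)
    have "(\<Sum>k. w k * (2 * (2 * p / l k) powr p)) = C / (L powr p * W) * V"
      unfolding term_eq V_def by (rule suminf_mult[OF summable_log_decay_0])
    also have "\<dots> = C * V / W / L powr p" by simp
    also have "\<dots> \<le> 1" using CVW L by (subst divide_le_eq_1_pos) auto
    finally show "(\<Sum>k. w k * (2 * (2 * p / l k) powr p)) \<le> 1" .
  qed
  have term_split: "w k * (l k / (1 + l k) ^ Suc y) = L / W * (log_decay (p + 1) k / (1 + l k) ^ Suc y)" for k y
    by (simp add: w_def l_def log_decay_add_1 mult_ac del: power_Suc)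
  note f = poisson_mixture_exponential_mixture[of w l, OF w_nonneg sums_summable[OF w_sums] l_pos,
      folded G_def, unfolded term_split]
  have LW: "0 < L / W" using L W by simp
  have f_summable: "summable (\<lambda>k. log_decay (p + 1) k / (1 + l k) ^ Suc y)" for y
    using f(1)[of y] LW by (subst (asm) summable_cmult_iff) auto
  have f_eq: "poisson_mixture G y = L / W * (\<Sum>k. log_decay (p + 1) k / (1 + l k) ^ Suc y)" for y
    unfolding f(2) by (rule suminf_mult[OF f_summable])
  obtain B where B: "0 < B" "\<And>l j y. \<lbrakk>\<And>k. 1 / 2 ^ k \<le> l k; 2 ^ j \<le> y\<rbrakk> \<Longrightarrow>
      (\<Sum>k. log_decay (p + 1) k / (1 + l k) ^ Suc y) \<le> B * log_decay (p + 1) j"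
    using log_decay_geometric_sum_le[of "p + 1"] p by auto
  show ?thesis
  proof
    show "G \<in> mixing_class p" by (rule G)
    show "0 < L / W * B" "0 < L / W * exp (- (2 * L))" using mult_pos_pos[OF LW] B(1) exp_gt_zero by blast+
    fix j y :: nat
    show "poisson_mixture G y \<le> L / W * B * log_decay (p + 1) j" if "2 ^ j \<le> y"
      unfolding f_eq mult.assoc
      by (rule mult_left_mono[OF B(2)[OF _ that]]) (use L LW in \<open>auto simp: l_def divide_right_mono\<close>)
    assume y: "y < 2 * 2 ^ j"
    \<comment> \<open>As \<open>Suc y \<le> 2 * 2 ^ j\<close>, the inequality
      \<open>1 + x \<le> exp x\<close> bounds the power by \<open>exp (2 * L)\<close>, uniformly in
      \<open>j\<close>.\<close>
    have "(1 + l j) ^ Suc y \<le> (1 + l j) ^ (2 * 2 ^ j)"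
      using l_pos[of j] y by (intro power_increasing) auto
    also have "\<dots> \<le> exp (l j) ^ (2 * 2 ^ j)"
      using l_pos[of j] by (intro power_mono exp_ge_add_one_self) auto
    also have "\<dots> = exp (2 * L)" by (simp add: exp_of_nat_mult[symmetric] l_def)
    finally have "log_decay (p + 1) j / exp (2 * L) \<le> log_decay (p + 1) j / (1 + l j) ^ Suc y"
      using l_pos[of j] log_decay_pos[of "p + 1" j]
      by (intro divide_left_mono) (auto simp del: power_Suc intro!: mult_pos_pos zero_less_power)
    then have "exp (- (2 * L)) * log_decay (p + 1) j \<le> log_decay (p + 1) j / (1 + l j) ^ Suc y"
      by (simp only: exp_minus divide_inverse mult.commute)
    also have "\<dots> \<le> (\<Sum>k. log_decay (p + 1) k / (1 + l k) ^ Suc y)"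
      using sum_le_suminf[OF f_summable, of "{j}" y] log_decay_pos[of "p + 1"] l_pos
      by (simp add: less_imp_le add_nonneg_nonneg del: power_Suc)
    finally show "L / W * exp (- (2 * L)) * log_decay (p + 1) j \<le> poisson_mixture G y"
      unfolding f_eq mult.assoc using LW by (intro mult_left_mono) auto
  qed
qed

section \<open>Choice of the dyadic block and the resulting rate\<close>

text \<open>Raise the hypothesis to the power \<open>p / (p + 1)\<close>. The geometric factor
  becomes that of \<open>log_decay p\<close>, and the power of \<open>i + 1\<close> becomes
  \<open>- 4 * p / (p + 1)\<close>; the second factor on the left completes it to -4.\<close>

lemma log_decay_ge_powr:
  fixes p :: real
  assumes p: "0 < p" and x: "0 < x" "1 / x \<le> log_decay (p + 1) i"
  shows "x powr (- (p / (p + 1))) * (real i + 1) powr (- (4 / (p + 1))) \<le> log_decay p i"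
proof -
  let ?N = "real i + 1"
  have "(1 / x) powr (p / (p + 1)) \<le> log_decay (p + 1) i powr (p / (p + 1))"
    using p x by (intro powr_mono2) auto
  also have "\<dots> = 2 powr (- (p * real i)) * ?N powr (- (4 * (p / (p + 1))))"
    using p by (simp add: log_decay_powr powr_mult powr_powr) (simp add: field_simps)
  finally have "x powr (- (p / (p + 1))) * ?N powr (- (4 / (p + 1)))
      \<le> 2 powr (- (p * real i)) * ?N powr (- (4 * (p / (p + 1)))) * ?N powr (- (4 / (p + 1)))"
    using x by (intro mult_right_mono) (auto simp: powr_divide powr_minus inverse_eq_divide)
  also have "\<dots> = 2 powr (- (p * real i)) * ?N powr (- 4)"
  proof -
    have "4 * (p / (p + 1)) + 4 / (p + 1) = (4 * p + 4) / (p + 1)"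
      by (simp add: add_divide_distrib)
    also have "\<dots> = 4" using p by (simp add: divide_eq_eq)
    finally have "- (4 * (p / (p + 1))) + - (4 / (p + 1)) = - 4" by linarith
    then show ?thesis by (simp add: mult.assoc powr_add[symmetric])
  qed
  also have "\<dots> = log_decay p i"
    by (rule log_decay_powr[symmetric])
  finally show ?thesis .
qed

text \<open>The sequence starts at 1, above \<open>e\<close>, and tends to 0, so the first index
  with value at most \<open>e\<close> is a successor.\<close>

lemma exists_last_log_decay_gt:
  assumes q: "0 < q" and e: "0 < e" "e < 1"
  obtains i where "e < log_decay q i" "log_decay q (Suc i) \<le> e"
proof -
  have "log_decay q \<longlonglongrightarrow> 0" using q by (intro summable_LIMSEQ_zero summable_log_decay) simp
  then have "\<forall>\<^sub>F k in sequentially. log_decay q k < e" using e(1) by (rule order_tendstoD)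
  then obtain k where k: "log_decay q k \<le> e" by (auto simp: eventually_sequentially intro: less_imp_le)
  then obtain i where "log_decay q (Suc i) \<le> e" "\<forall>j\<le>i. \<not> log_decay q j \<le> e"
    using ex_least_nat_less[of "\<lambda>k. log_decay q k \<le> e" k] e(2) by auto
  then show ?thesis using that[of i] by auto
qed

theorem proposition26:
  fixes p :: real
  assumes "p > 0"
  shows "\<exists>G\<in>mixing_class p. \<exists>c>0. \<forall>n\<ge>2.
    expected_hellinger_sq G n \<ge> c * real n powr (- (p / (p + 1))) * ln (real n) powr (- (4 / (p + 1)))"
proof -
  obtain G B0 K where G: "G \<in> mixing_class p" and B0: "0 < B0" and K: "0 < K"
    and upper: "\<And>j y. 2 ^ j \<le> y \<Longrightarrow> poisson_mixture G y \<le> B0 * log_decay (p + 1) j"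
    and lower: "\<And>j y. y < 2 * 2 ^ j \<Longrightarrow> K * log_decay (p + 1) j \<le> poisson_mixture G y"
    using exists_log_decay_poisson_mixture[OF assms] by blast
  \<comment> \<open>\<open>2 * B0 \<le> B\<close> will give the cells of the block
    \<open>n * f \<le> 1 / 2\<close>; \<open>1 \<le> B\<close> keeps \<open>ln B\<close> nonnegative
    and \<open>1 / (B * n)\<close> below 1.\<close>
  define B where "B = max 1 (2 * B0)"
  have B: "1 \<le> B" "2 * B0 \<le> B" by (auto simp: B_def)
  define C where "C = (ln B / ln 2 + 2) / ln 2"
  have C: "0 < C" using B(1) by (auto simp: C_def intro!: divide_pos_pos add_nonneg_pos)
  define a where "a = - (p / (p + 1))"
  define b where "b = - (4 / (p + 1))"
  \<comment> \<open>\<open>K / 2\<close> comes from the lower bound on cells and the chance of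
    missing them, \<open>2 powr (- p) / 16\<close> from the step \<open>i\<close> to
    \<open>Suc i\<close>, the rest from comparing \<open>B * n\<close> and \<open>i + 1\<close> with
    \<open>n\<close> and \<open>ln n\<close>.\<close>
  define c where "c = K / 2 * (2 powr (- p) / 16) * B powr a * C powr b"
  have c: "0 < c" using K B(1) C by (auto simp: c_def intro!: mult_pos_pos)
  have "c * real n powr a * ln (real n) powr b \<le> expected_hellinger_sq G n" if n: "2 \<le> n" for n
  proof -
    have Bn: "1 < B * real n" using B(1) n mult_mono[of 1 B 2 "real n"] by auto
    \<comment> \<open>At \<open>Suc i\<close> the cells are rare enough to be missed; the bound at
      \<open>i\<close> keeps the block from being too light.\<close>
    obtain i where i: "1 / (B * real n) < log_decay (p + 1) i"
        "log_decay (p + 1) (Suc i) \<le> 1 / (B * real n)"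
      using exists_last_log_decay_gt[of "p + 1" "1 / (B * real n)"] assms Bn by auto
    define A :: "nat set" where "A = {2 ^ Suc i..<2 * 2 ^ Suc i}"
    have card_A: "real (card A) = 2 ^ Suc i" by (simp add: A_def)
    \<comment> \<open>The threshold is crossed after logarithmically many steps, because
      \<open>log_decay (p + 1) i\<close> is at most \<open>2 powr (- i)\<close>.\<close>
    have "real i * ln 2 \<le> ln (B * real n)"
    proof -
      have "log_decay (p + 1) i \<le> 2 powr (- real i)"
      proof -
        have "log_decay (p + 1) i \<le> 2 powr (- ((p + 1) * real i))"
          using log_decay_add_le[of "p + 1" i 0] by simp
        also have "\<dots> \<le> 2 powr (- real i)"
          using assms by (intro powr_mono) (auto simp: algebra_simps)
        finally show ?thesis .
      qed
      with i(1) have "1 / (B * real n) < 1 / 2 ^ i"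
        by (simp add: powr_minus powr_realpow inverse_eq_divide)
      then have "2 ^ i < B * real n" using Bn by (simp add: field_simps)
      then have "ln (2 ^ i) < ln (B * real n)" using Bn by (subst ln_less_cancel_iff) auto
      then show ?thesis by (simp add: ln_realpow)
    qed
    also have "\<dots> = ln B + ln (real n)" using B(1) n by (simp add: ln_mult)
    finally have "(real i + 1) * ln 2 \<le> ln B + ln 2 + ln (real n)" by (simp add: algebra_simps)
    \<comment> \<open>As \<open>ln 2 \<le> ln n\<close>, the additive constants are absorbed into a
      multiple of \<open>ln n\<close>.\<close>
    also have "\<dots> \<le> (ln B / ln 2 + 2) * ln (real n)"
    proof -
      have l2: "ln 2 \<le> ln (real n)" using n by simp
      have "ln B = ln B / ln 2 * ln 2" by simp
      also have "\<dots> \<le> ln B / ln 2 * ln (real n)" using B(1) l2 by (intro mult_left_mono) auto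
      finally show ?thesis using l2 by (simp add: algebra_simps)
    qed
    finally have iC: "real i + 1 \<le> C * ln (real n)" by (simp add: C_def pos_le_divide_eq)
    have b_le: "b \<le> 0" using assms by (simp add: b_def)
    have "B powr a * real n powr a * (C powr b * ln (real n) powr b)
        = (B * real n) powr a * (C * ln (real n)) powr b"
      using B(1) C n by (simp add: powr_mult)
    \<comment> \<open>The exponent \<open>b\<close> is nonpositive, so the upper bound on
      \<open>i + 1\<close> bounds its power from below.\<close>
    also have "\<dots> \<le> (B * real n) powr a * (real i + 1) powr b"
      using iC b_le by (intro mult_left_mono powr_mono2') auto
    also have "\<dots> \<le> log_decay p i"
      unfolding a_def b_def using assms Bn i(1) by (intro log_decay_ge_powr) auto
    also have "\<dots> \<le> log_decay p (Suc i) * (2 powr p * 16)"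
      using log_decay_le_add[of p i 1] by simp
    finally have "K / 2 * (2 powr (- p) / 16) * (B powr a * real n powr a * (C powr b * ln (real n) powr b))
        \<le> K / 2 * (2 powr (- p) / 16) * (log_decay p (Suc i) * (2 powr p * 16))"
      using K by (intro mult_left_mono) auto
    also have "\<dots> = K * log_decay p (Suc i) / 2" by (simp add: powr_minus)
    finally have "c * real n powr a * ln (real n) powr b \<le> K * log_decay p (Suc i) / 2"
      unfolding c_def by (simp only: mult_ac)
    also have "\<dots> = (\<Sum>y\<in>A. K * log_decay (p + 1) (Suc i)) / 2"
      by (simp add: log_decay_add_1 card_A)
    also have "\<dots> \<le> (\<Sum>y\<in>A. poisson_mixture G y) / 2"
      by (intro divide_right_mono sum_mono lower) (auto simp: A_def)
    also have "\<dots> \<le> expected_hellinger_sq G n"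
    proof (rule expected_hellinger_sq_ge[OF G])
      fix y assume "y \<in> A"
      then have "poisson_mixture G y \<le> B0 * log_decay (p + 1) (Suc i)" by (intro upper) (simp add: A_def)
      also have "\<dots> \<le> B / 2 * (1 / (B * real n))"
        using i(2) B B0 by (intro mult_mono) (auto simp: less_imp_le log_decay_pos)
      also have "\<dots> = 1 / (2 * real n)" using B(1) by simp
      finally show "real n * poisson_mixture G y \<le> 1 / 2" using n by (simp add: field_simps)
    qed (use n in \<open>auto simp: A_def\<close>)
    finally show ?thesis .
  qed
  with G c show ?thesis unfolding a_def b_def by blast
qed

end
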